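(* Let $\rho > 2$ and let $f \colon \mathbb{R}^2 \to \mathbb{R}$ be a band-limited function in the Sobolev space $W_2^{\rho}(\mathbb{R}^2)$. Let $0 < T < 1$ and let $\theta_1,\theta_2$ be grid angles, as specified in the context, with associated quantities $\alpha,\beta,\gamma$ and $\epsilon_{\mathbf{\Xi},\mathrm{asym}}(f)$ defined there. Then $$\epsilon_{\mathbf{\Xi},\mathrm{asym}}(f) \le \frac{1}{12\sqrt{5}}\, C(\theta_1,\theta_2)\, T^2\, \|\mathbf{H}_f\|_{F,L_2},$$ where $C(\theta_1,\theta_2) = (\alpha^2+\beta^2+\gamma^2)^{\frac12}$, $\mathbf{H}_f$ is the Hessian of $f$, and $\|\mathbf{A}(\cdot)\|_{F,L_2} = \big(\int_{\mathbb{R}^2} \|\mathbf{A}(\mathbf{x})\|_F^2 \,\mathrm{d}\mathbf{x}\big)^{\frac12}$ with $\|\cdot\|_F$ the Frobenius norm.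
   Context: The angles satisfy $0 \le \theta_1 < 2\pi$ and $\delta = \theta_2-\theta_1 \in (0,2\pi)$ with $\delta\neq\pi$. The grid matrix with stepsize $T$ and angles $\theta_1,\theta_2$ is $$\mathbf{\Xi} = \frac{T}{\sqrt{|\sin(\theta_2-\theta_1)|}} \begin{bmatrix} \cos\theta_1 & \cos\theta_2 \\ \sin\theta_1 & \sin\theta_2 \end{bmatrix}.$$ Define $$\alpha = \frac{\cos^2(\theta_1) + \cos(\theta_1)\cos(\theta_2) + \cos^2(\theta_2)}{|\sin(\theta_2-\theta_1)|},$$ $$\beta = \frac{\sin^2(\theta_1) + \sin(\theta_1)\sin(\theta_2) + \sin^2(\theta_2)}{|\sin(\theta_2-\theta_1)|},$$ $$\gamma = \frac{\sin(2\theta_1) + \sin(\theta_1+\theta_2) + \sin(2\theta_2)}{|\sin(\theta_2-\theta_1)|},$$ and $$\epsilon_{\mathbf{\Xi},\mathrm{asym}}(f) = \frac{T^2}{12\sqrt{5}} \left( \int_{\mathbb{R}^2} \left\langle \mathbf{H}_f(\mathbf{x}), \begin{bmatrix} \alpha & \gamma \\ 0 & \beta \end{bmatrix} \right\rangle^2 \mathrm{d}\mathbf{x} \right)^{\frac12},$$ where $\langle \mathbf{A},\mathbf{B}\rangle = \sum_{i,j}A_{ij}B_{ij}$ is the Frobenius inner product. "Band-limited" means that the Fourier transform of $f$ has compact support. Functions are real-valued. *)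

theory Defs
  imports "HOL-Analysis.Analysis"
begin

section \<open>Square-integrable functions on the plane\<close>

definition square_integrable :: "(real^2 \<Rightarrow> 'b::euclidean_space) \<Rightarrow> bool" where
  "square_integrable f \<longleftrightarrow>
     f \<in> borel_measurable lebesgue \<and> integrable lebesgue (\<lambda>x. (norm (f x))\<^sup>2)"

text \<open>Norms are integrals of nonnegative functions and take values in \<open>[0,\<infinity>]\<close>, so that no
  finite default value is assigned to a divergent integral.\<close>

definition ennreal_sqrt :: "ennreal \<Rightarrow> ennreal" where
  "ennreal_sqrt a = (if a = top then top else ennreal (sqrt (enn2real a)))"

text \<open>On \<open>real^2^2\<close> the library's \<open>norm\<close> and \<open>\<bullet>\<close> are the Frobenius norm and the Frobenius
  inner product. Hence for matrix-valued \<open>g\<close> this is the norm with subscript \<open>F, L\<^sub>2\<close>.\<close>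

definition L2_norm :: "(real^2 \<Rightarrow> 'b::euclidean_space) \<Rightarrow> ennreal" where
  "L2_norm g = ennreal_sqrt (\<integral>\<^sup>+ x. ennreal ((norm (g x))\<^sup>2) \<partial>lebesgue)"

section \<open>Fourier transform, band-limitedness, Sobolev spaces\<close>

definition truncated_fourier :: "real \<Rightarrow> (real^2 \<Rightarrow> real) \<Rightarrow> real^2 \<Rightarrow> complex" where
  "truncated_fourier R f \<xi> =
     (LINT x:cball 0 R|lebesgue. complex_of_real (f x) * cis (- (\<xi> \<bullet> x)))"

text \<open>The Fourier transform on \<open>L\<^sub>2\<close> is the limit in \<open>L\<^sub>2\<close> of the transforms of the truncations
  of \<open>f\<close> to balls; it is determined up to null sets.\<close>

definition is_fourier_transform :: "(real^2 \<Rightarrow> real) \<Rightarrow> (real^2 \<Rightarrow> complex) \<Rightarrow> bool" where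
  "is_fourier_transform f F \<longleftrightarrow>
     square_integrable f \<and> square_integrable F \<and>
     ((\<lambda>R. L2_norm (\<lambda>\<xi>. truncated_fourier R f \<xi> - F \<xi>)) \<longlongrightarrow> 0) at_top"

definition band_limited :: "(real^2 \<Rightarrow> real) \<Rightarrow> bool" where
  "band_limited f \<longleftrightarrow>
     (\<exists>F K. is_fourier_transform f F \<and> compact K \<and> (AE \<xi> in lebesgue. \<xi> \<notin> K \<longrightarrow> F \<xi> = 0))"

definition sobolev_space :: "real \<Rightarrow> (real^2 \<Rightarrow> real) set" where
  "sobolev_space \<rho> =
     {f. \<exists>F. is_fourier_transform f F \<and>
             square_integrable (\<lambda>\<xi>. ((1 + (norm \<xi>)\<^sup>2) powr (\<rho> / 2)) *\<^sub>R F \<xi>)}"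

section \<open>The Hessian\<close>

definition partial_deriv :: "2 \<Rightarrow> (real^2 \<Rightarrow> real) \<Rightarrow> real^2 \<Rightarrow> real" where
  "partial_deriv i f x = frechet_derivative f (at x) (axis i 1)"

primrec times_cont_differentiable :: "nat \<Rightarrow> (real^2 \<Rightarrow> real) \<Rightarrow> bool" where
  "times_cont_differentiable 0 f \<longleftrightarrow> continuous_on UNIV f"
| "times_cont_differentiable (Suc k) f \<longleftrightarrow>
     (\<forall>x. f differentiable (at x)) \<and> (\<forall>i. times_cont_differentiable k (partial_deriv i f))"

definition test_function :: "(real^2 \<Rightarrow> real) \<Rightarrow> bool" where
  "test_function \<phi> \<longleftrightarrow>
     (\<forall>k. times_cont_differentiable k \<phi>) \<and> (\<exists>K. compact K \<and> (\<forall>x. x \<notin> K \<longrightarrow> \<phi> x = 0))"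

definition locally_integrable :: "(real^2 \<Rightarrow> real) \<Rightarrow> bool" where
  "locally_integrable g \<longleftrightarrow> (\<forall>K. compact K \<longrightarrow> set_integrable lebesgue K g)"

text \<open>Elements of a Sobolev space are determined only up to null sets, so derivatives are weak
  derivatives. For twice continuously differentiable \<open>f\<close> these are the classical ones.\<close>

definition is_hessian :: "(real^2 \<Rightarrow> real) \<Rightarrow> (real^2 \<Rightarrow> real^2^2) \<Rightarrow> bool" where
  "is_hessian f H \<longleftrightarrow>
     locally_integrable f \<and> (\<forall>i j. locally_integrable (\<lambda>x. H x $ i $ j)) \<and>
     (\<forall>\<phi> i j. test_function \<phi> \<longrightarrow>
        (LINT x|lebesgue. f x * partial_deriv i (partial_deriv j \<phi>) x) =
        (LINT x|lebesgue. H x $ i $ j * \<phi> x))"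

text \<open>A weak Hessian is unique up to null sets, and one exists for every function in
  \<open>sobolev_space \<rho>\<close> with \<open>\<rho> \<ge> 2\<close>. \<open>L2_norm\<close> does not depend on the representative.\<close>

definition hessian :: "(real^2 \<Rightarrow> real) \<Rightarrow> real^2 \<Rightarrow> real^2^2" where
  "hessian f = (SOME H. is_hessian f H)"

section \<open>Grid quantities\<close>

definition grid_angles :: "real \<Rightarrow> real \<Rightarrow> bool" where
  "grid_angles \<theta>1 \<theta>2 \<longleftrightarrow>
     0 \<le> \<theta>1 \<and> \<theta>1 < 2 * pi \<and> 0 < \<theta>2 - \<theta>1 \<and> \<theta>2 - \<theta>1 < 2 * pi \<and> \<theta>2 - \<theta>1 \<noteq> pi"

definition grid_alpha :: "real \<Rightarrow> real \<Rightarrow> real" where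
  "grid_alpha \<theta>1 \<theta>2 =
     ((cos \<theta>1)\<^sup>2 + cos \<theta>1 * cos \<theta>2 + (cos \<theta>2)\<^sup>2) / \<bar>sin (\<theta>2 - \<theta>1)\<bar>"

definition grid_beta :: "real \<Rightarrow> real \<Rightarrow> real" where
  "grid_beta \<theta>1 \<theta>2 =
     ((sin \<theta>1)\<^sup>2 + sin \<theta>1 * sin \<theta>2 + (sin \<theta>2)\<^sup>2) / \<bar>sin (\<theta>2 - \<theta>1)\<bar>"

definition grid_gamma :: "real \<Rightarrow> real \<Rightarrow> real" where
  "grid_gamma \<theta>1 \<theta>2 =
     (sin (2 * \<theta>1) + sin (\<theta>1 + \<theta>2) + sin (2 * \<theta>2)) / \<bar>sin (\<theta>2 - \<theta>1)\<bar>"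

definition grid_coeff_matrix :: "real \<Rightarrow> real \<Rightarrow> real^2^2" where
  "grid_coeff_matrix \<theta>1 \<theta>2 =
     vector [vector [grid_alpha \<theta>1 \<theta>2, grid_gamma \<theta>1 \<theta>2],
             vector [0, grid_beta \<theta>1 \<theta>2]]"

definition grid_constant :: "real \<Rightarrow> real \<Rightarrow> real" where
  "grid_constant \<theta>1 \<theta>2 =
     sqrt ((grid_alpha \<theta>1 \<theta>2)\<^sup>2 + (grid_beta \<theta>1 \<theta>2)\<^sup>2 + (grid_gamma \<theta>1 \<theta>2)\<^sup>2)"

definition asym_error :: "real \<Rightarrow> real \<Rightarrow> real \<Rightarrow> (real^2 \<Rightarrow> real) \<Rightarrow> ennreal" where
  "asym_error T \<theta>1 \<theta>2 f =
     ennreal (T\<^sup>2 / (12 * sqrt 5)) *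
     ennreal_sqrt
       (\<integral>\<^sup>+ x. ennreal ((hessian f x \<bullet> grid_coeff_matrix \<theta>1 \<theta>2)\<^sup>2) \<partial>lebesgue)"

end

theory Submission
  imports Defs
begin

text \<open>The inequality is the pointwise Cauchy--Schwarz inequality for the Frobenius inner product,
  \<open>(hessian f x \<bullet> G)\<^sup>2 \<le> (norm G)\<^sup>2 * (norm (hessian f x))\<^sup>2\<close>, integrated over the plane, since the
  coefficient matrix \<open>G\<close> is constant and its Frobenius norm is the constant \<open>grid_constant\<close>
  (lemma \<open>norm_grid_coeff_matrix\<close>).

  The inequality is integrated for an arbitrary matrix field, which may fail to be measurable,
  while the usual rule for pulling a constant factor out of a nonnegative integral requires
  measurability.
  The integral is defined as a supremum of integrals of simple functions from below, and this
  supremum scales for every integrand; lemma \<open>nn_integral_cmult_le\<close> gives the half that is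
  needed.\<close>

text \<open>A simple function below \<open>c * f\<close> becomes, after division by \<open>c\<close>, a simple function below \<open>f\<close>.
  Only these simple functions have to be measurable.\<close>

lemma nn_integral_cmult_le:
  fixes f :: "'a \<Rightarrow> ennreal" and c :: real
  assumes "0 \<le> c"
  shows "(\<integral>\<^sup>+ x. ennreal c * f x \<partial>M) \<le> ennreal c * (\<integral>\<^sup>+ x. f x \<partial>M)"
proof (cases "c = 0")
  case False
  with assms have c: "0 < c" by simp
  have inv: "ennreal c * (ennreal (1 / c) * y) = y" "ennreal (1 / c) * (ennreal c * y) = y" for y
    using c by (simp_all add: mult.assoc[symmetric] ennreal_mult[symmetric])
  show ?thesis
    unfolding nn_integral_def[of M "\<lambda>x. ennreal c * f x"]
  proof (rule SUP_least)
    fix s assume "s \<in> {g. simple_function M g \<and> g \<le> (\<lambda>x. ennreal c * f x)}"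
    then have s: "simple_function M s" and le: "\<And>x. s x \<le> ennreal c * f x"
      by (auto simp: le_fun_def)
    have meas: "s \<in> borel_measurable M"
      using s by (rule borel_measurable_simple_function)
    have "integral\<^sup>S M s = (\<integral>\<^sup>+ x. ennreal c * (ennreal (1 / c) * s x) \<partial>M)"
      using s by (simp add: inv nn_integral_eq_simple_integral)
    also have "\<dots> = ennreal c * (\<integral>\<^sup>+ x. ennreal (1 / c) * s x \<partial>M)"
      using meas by (intro nn_integral_cmult) measurable
    also have "\<dots> \<le> ennreal c * (\<integral>\<^sup>+ x. f x \<partial>M)"
    proof (intro mult_left_mono nn_integral_mono)
      fix x
      show "ennreal (1 / c) * s x \<le> f x"
        using mult_left_mono[OF le[of x], of "ennreal (1 / c)"] by (simp add: inv)
    qed simp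
    finally show "integral\<^sup>S M s \<le> ennreal c * (\<integral>\<^sup>+ x. f x \<partial>M)" .
  qed
qed simp

lemma ennreal_sqrt_mono:
  assumes "a \<le> b"
  shows "ennreal_sqrt a \<le> ennreal_sqrt b"
proof (cases "b = top")
  case False
  then have "a \<noteq> top" "b < top"
    using assms by (auto simp: top_unique less_top)
  with False assms show ?thesis
    by (simp add: ennreal_sqrt_def ennreal_leI enn2real_mono)
qed (simp add: ennreal_sqrt_def)

text \<open>For \<open>c = 0\<close> and \<open>a = \<infinity>\<close> both sides vanish, because \<open>0 * \<infinity> = 0\<close> in the extended
  nonnegative reals.\<close>

lemma ennreal_sqrt_cmult:
  assumes "0 \<le> c"
  shows "ennreal_sqrt (ennreal (c\<^sup>2) * a) = ennreal c * ennreal_sqrt a"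
proof (cases a)
  case (real r)
  with assms show ?thesis
    by (simp add: ennreal_sqrt_def ennreal_mult[symmetric] real_sqrt_mult)
next
  case top
  with assms show ?thesis
    by (simp add: ennreal_sqrt_def ennreal_mult_top)
qed

lemma L2_norm_inner_const_le:
  fixes H :: "real^2 \<Rightarrow> 'b::euclidean_space"
  shows "ennreal_sqrt (\<integral>\<^sup>+ x. ennreal ((H x \<bullet> G)\<^sup>2) \<partial>lebesgue) \<le> ennreal (norm G) * L2_norm H"
proof -
  have "(\<integral>\<^sup>+ x. ennreal ((H x \<bullet> G)\<^sup>2) \<partial>lebesgue)
      \<le> (\<integral>\<^sup>+ x. ennreal ((norm G)\<^sup>2) * ennreal ((norm (H x))\<^sup>2) \<partial>lebesgue)"
  proof (intro nn_integral_mono)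
    fix x
    have "(H x \<bullet> G)\<^sup>2 \<le> (norm G)\<^sup>2 * (norm (H x))\<^sup>2"
      using Cauchy_Schwarz_ineq[of "H x" G] by (simp add: power2_norm_eq_inner mult.commute)
    then show "ennreal ((H x \<bullet> G)\<^sup>2) \<le> ennreal ((norm G)\<^sup>2) * ennreal ((norm (H x))\<^sup>2)"
      by (simp add: ennreal_mult[symmetric] ennreal_leI)
  qed
  also have "\<dots> \<le> ennreal ((norm G)\<^sup>2) * (\<integral>\<^sup>+ x. ennreal ((norm (H x))\<^sup>2) \<partial>lebesgue)"
    by (rule nn_integral_cmult_le) simp
  finally show ?thesis
    unfolding L2_norm_def
    by (subst ennreal_sqrt_cmult[symmetric]) (simp_all add: ennreal_sqrt_mono)
qed

lemma norm_grid_coeff_matrix: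
  "norm (grid_coeff_matrix \<theta>1 \<theta>2) = grid_constant \<theta>1 \<theta>2"
  by (simp add: norm_eq_sqrt_inner inner_vec_def sum_2 grid_coeff_matrix_def grid_constant_def
      power2_eq_square algebra_simps)

theorem theorem2:
  fixes \<rho> T \<theta>1 \<theta>2 :: real and f :: "real^2 \<Rightarrow> real"
  assumes "\<rho> > 2"
    and "band_limited f"
    and "f \<in> sobolev_space \<rho>"
    and "0 < T" and "T < 1"
    and "grid_angles \<theta>1 \<theta>2"
  shows "asym_error T \<theta>1 \<theta>2 f
           \<le> ennreal (1 / (12 * sqrt 5) * grid_constant \<theta>1 \<theta>2 * T\<^sup>2) * L2_norm (hessian f)"
proof -
  let ?C = "grid_constant \<theta>1 \<theta>2"
  have C: "0 \<le> ?C"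
    by (simp add: grid_constant_def)
  have "asym_error T \<theta>1 \<theta>2 f
      \<le> ennreal (T\<^sup>2 / (12 * sqrt 5)) * (ennreal ?C * L2_norm (hessian f))"
    unfolding asym_error_def norm_grid_coeff_matrix[symmetric]
    by (intro mult_left_mono L2_norm_inner_const_le) simp
  also have "\<dots> = ennreal (T\<^sup>2 / (12 * sqrt 5) * ?C) * L2_norm (hessian f)"
    using C by (subst ennreal_mult) (simp_all add: mult.assoc)
  also have "T\<^sup>2 / (12 * sqrt 5) * ?C = 1 / (12 * sqrt 5) * ?C * T\<^sup>2"
    by simp
  finally show ?thesis .
qed

end
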